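(* Let $A\in\mathbb{R}^{m\times n}$, $b\in\mathbb{R}^m$, $c\in\mathbb{R}^n$ satisfy assumptions (A1) and (A2) of the context. Let $\tau\in(0,1/\sqrt{2n}]$, let $\mu_1>0$ and $\mu_{k+1}=(1-\tau)\mu_k$ for $k\ge 1$, and let $(x_k)_{k\ge1}$ be a sequence in $\mathcal{F}_p^0$ (the iterates of some algorithm) such that $\delta(x_k,\mu_k)\le \frac{\sqrt2}{2}$ for all $k=1,2,\dots$. Then $\|x_i-x_j\|=\mathcal{O}(\mu_k)$ for all $i,j\ge k$; that is, there is a constant $C$ depending only on $(A,b,c)$ and $\tau$ such that $\|x_i-x_j\|\le C\mu_k$ for all $k\ge1$ and all $i,j\ge k$.
   Context: Primal LP: minimize $\langle c,x\rangle$ subject to $Ax=b$, $x\ge 0$. Dual LP: maximize $\langle b,y\rangle$ subject to $A^\top y+s=c$, $s\ge0$. $\mathcal{F}_p=\{x: Ax=b, x\ge0\}$, $\mathcal{F}_d=\{(y,s):A^\top y+s=c, s\ge0\}$; $\mathcal{F}_p^0,\mathcal{F}_d^0$ are the subsets where $x>0$, respectively $s>0$. $X=\mathrm{diag}(x)$, $e$ is the all-ones vector, $\|\cdot\|$ is the Euclidean norm. Proximity measure: for $x\in\mathcal{F}_p^0$, $\mu>0$, $\delta(x,\mu)=\min_{(y,s)\in\mathcal{F}_d}\|\frac1\mu Xs-e\|$, identified in the paper with $\|P_{AX}(\frac1\mu Xc-e)\|$, where $P_{AX}=I-XA^\top(AX^2A^\top)^{-1}AX$ (the two agree whenever either value is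 at most $1$). Maximal complementarity partition: $\mathcal{B}=\{j: x_j^\star>0$ for some primal optimal $x^\star\}$, $\mathcal{N}=\{j:s_j^\star>0$ for some dual optimal $(y^\star,s^\star)\}$; under (A1) these partition $\{1,\dots,n\}$. (A1): $\mathcal{F}_p^0$ and $\mathcal{F}_d^0$ are nonempty and $A$ has full row rank. (A2): the primal problem is non-degenerate (standard sense: every basic feasible solution has exactly $m$ positive components) and $|\mathcal{B}|=m$. Under these assumptions the primal optimal solution is unique. *)

theory Defs
  imports "HOL-Analysis.Analysis"
begin

definition primal_feasible :: "real^'n^'m \<Rightarrow> real^'m \<Rightarrow> (real^'n) set" where
  "primal_feasible A b = {x. A *v x = b \<and> (\<forall>j. 0 \<le> x $ j)}"

definition dual_feasible :: "real^'n^'m \<Rightarrow> real^'n \<Rightarrow> ((real^'m) \<times> (real^'n)) set" where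
  "dual_feasible A c = {(y, s). transpose A *v y + s = c \<and> (\<forall>j. 0 \<le> s $ j)}"

definition primal_interior :: "real^'n^'m \<Rightarrow> real^'m \<Rightarrow> (real^'n) set" where
  "primal_interior A b = {x \<in> primal_feasible A b. \<forall>j. 0 < x $ j}"

definition dual_interior :: "real^'n^'m \<Rightarrow> real^'n \<Rightarrow> ((real^'m) \<times> (real^'n)) set" where
  "dual_interior A c = {(y, s) \<in> dual_feasible A c. \<forall>j. 0 < s $ j}"

definition primal_optimal :: "real^'n^'m \<Rightarrow> real^'m \<Rightarrow> real^'n \<Rightarrow> (real^'n) set" where
  "primal_optimal A b c =
     {x \<in> primal_feasible A b. \<forall>x' \<in> primal_feasible A b. c \<bullet> x \<le> c \<bullet> x'}"

definition B_part :: "real^'n^'m \<Rightarrow> real^'m \<Rightarrow> real^'n \<Rightarrow> 'n set" where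
  "B_part A b c = {j. \<exists>x \<in> primal_optimal A b c. 0 < x $ j}"

text \<open>
  A basic solution is determined by a basis, i.e. \<open>m\<close> column indices whose columns form a
  nonsingular submatrix. Injectivity is needed because \<open>independent\<close> speaks about the set
  of columns, in which repeated columns would collapse.
\<close>
definition basic_feasible :: "real^'n^'m \<Rightarrow> real^'m \<Rightarrow> (real^'n) set" where
  "basic_feasible A b = {x \<in> primal_feasible A b.
     \<exists>J. card J = CARD('m) \<and> inj_on (\<lambda>j. column j A) J \<and>
         independent ((\<lambda>j. column j A) ` J) \<and> (\<forall>j. j \<notin> J \<longrightarrow> x $ j = 0)}"

definition primal_nondegenerate :: "real^'n^'m \<Rightarrow> real^'m \<Rightarrow> bool" where
  "primal_nondegenerate A b \<longleftrightarrow>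
     (\<forall>x \<in> basic_feasible A b. card {j. 0 < x $ j} = CARD('m))"

definition assumption_A1 :: "real^'n^'m \<Rightarrow> real^'m \<Rightarrow> real^'n \<Rightarrow> bool" where
  "assumption_A1 A b c \<longleftrightarrow>
     primal_interior A b \<noteq> {} \<and> dual_interior A c \<noteq> {} \<and> rank A = CARD('m)"

definition assumption_A2 :: "real^'n^'m \<Rightarrow> real^'m \<Rightarrow> real^'n \<Rightarrow> bool" where
  "assumption_A2 A b c \<longleftrightarrow>
     primal_nondegenerate A b \<and> card (B_part A b c) = CARD('m)"

definition diag_mat :: "real^'n \<Rightarrow> real^'n^'n" where
  "diag_mat x = (\<chi> i j. if i = j then x $ i else 0)"

text \<open>
  The minimum over the dual feasible set is written as an infimum; by \<open>proximity_attained\<close>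
  below it is attained whenever the dual feasible set is nonempty. The constant \<open>1\<close> of type
  \<^typ>\<open>real^'n\<close> is the all-ones vector.
\<close>
definition proximity :: "real^'n^'m \<Rightarrow> real^'n \<Rightarrow> real^'n \<Rightarrow> real \<Rightarrow> real" where
  "proximity A c x \<mu> =
     (INF (y, s) \<in> dual_feasible A c. norm ((1 / \<mu>) *\<^sub>R (diag_mat x *v s) - 1))"

lemma diag_mat_mult: "diag_mat x *v s = (\<chi> i. x $ i * s $ i)"
  by (simp add: diag_mat_def matrix_vector_mult_def vec_eq_iff if_distrib if_distribR cong: if_cong)

lemma proximity_attained:
  fixes A :: "real^'n^'m" and c :: "real^'n"
  assumes "dual_feasible A c \<noteq> {}" "\<forall>j. 0 < x $ j" "0 < \<mu>"
  shows "\<exists>(y, s) \<in> dual_feasible A c.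
     proximity A c x \<mu> = norm ((1 / \<mu>) *\<^sub>R (diag_mat x *v s) - 1)"
proof -
  let ?f = "\<lambda>s. (1 / \<mu>) *\<^sub>R (diag_mat x *v s)"
  let ?S = "snd ` dual_feasible A c"
  have S: "?S = (\<lambda>v. c - v) ` range (\<lambda>y. transpose A *v y) \<inter> {s. \<forall>j. 0 \<le> s $ j}"
    by (force simp: dual_feasible_def image_iff algebra_simps)
  have "closed (range (\<lambda>y. transpose A *v y))"
    by (intro closed_subspace linear_subspace_image matrix_vector_mul_linear subspace_UNIV)
  then have "closed ((+) c ` uminus ` range (\<lambda>y. transpose A *v y))"
    by (intro closed_translation closed_negations)
  then have "closed ((\<lambda>v. c - v) ` range (\<lambda>y. transpose A *v y))"
    by (simp add: image_image)
  moreover have "closed {s::real^'n. \<forall>j. 0 \<le> s $ j}"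
    by (intro closed_Collect_all closed_Collect_le continuous_intros)
  ultimately have "closed ?S" unfolding S by blast
  moreover have "linear ?f"
    by (intro linear_compose_scale_right matrix_vector_mul_linear)
  moreover have "inj ?f"
    using assms(2,3) by (auto simp: inj_def diag_mat_mult vec_eq_iff less_imp_neq)
       (metis less_irrefl)
  ultimately have "closed (?f ` ?S)"
    by (rule closed_injective_linear_image)
  then obtain z where z: "z \<in> ?f ` ?S" "\<And>w. w \<in> ?f ` ?S \<Longrightarrow> dist 1 z \<le> dist 1 w"
    using distance_attains_inf[of "?f ` ?S" 1] assms(1) by blast
  then obtain y s where ys: "(y, s) \<in> dual_feasible A c" "z = ?f s" by auto
  have "proximity A c x \<mu> = norm (?f s - 1)"
    unfolding proximity_def
  proof (rule cInf_eq_minimum)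
    show "norm (?f s - 1) \<in> (\<lambda>(y, s). norm (?f s - 1)) ` dual_feasible A c"
      using ys(1) by force
    show "norm (?f s - 1) \<le> r" if "r \<in> (\<lambda>(y, s). norm (?f s - 1)) ` dual_feasible A c" for r
      using that z(2) unfolding ys(2) by (force simp: dist_norm norm_minus_commute)
  qed
  then show ?thesis using ys(1) by blast
qed

end

theory Submission
  imports Defs
begin

text \<open>
  The iterate \<open>x\<^sub>k\<close> has duality gap at most \<open>2n\<mu>\<^sub>k\<close>, so it is enough that the optimal
  solution \<open>z\<close> is a sharp minimum: \<open>\<parallel>x - z\<parallel> \<le> K \<langle>c, x - z\<rangle>\<close> on the feasible set. A feasible
  point whose support has least cardinality is basic, hence by non-degeneracy every feasible
  point has at least \<open>m\<close> positive entries. An optimal \<open>z\<close> is supported in \<open>\<B>\<close>, so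
  \<open>|\<B>| = m\<close> forces its support to be \<open>\<B>\<close>, and the columns of \<open>\<B>\<close> form a basis. Every
  direction \<open>x - z\<close> is then a nonnegative combination of the edge directions \<open>D\<^sub>j\<close>,
  \<open>j \<notin> \<B>\<close>, that raise coordinate \<open>j\<close> and adjust only the coordinates in \<open>\<B>\<close>. A small step
  along \<open>D\<^sub>j\<close> stays feasible and, as \<open>j \<notin> \<B>\<close>, is not optimal; so \<open>\<langle>c, D\<^sub>j\<rangle> > 0\<close>, which
  yields sharpness with \<open>K = \<Sum>\<^sub>j \<parallel>D\<^sub>j\<parallel> / \<langle>c, D\<^sub>j\<rangle>\<close>.
\<close>

section \<open>Linear algebra of column subsets indexed by \<open>S\<close>\<close>

definition supported_on :: "'n set \<Rightarrow> (real^'n) set" where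
  "supported_on S = {d. \<forall>j. j \<notin> S \<longrightarrow> d $ j = 0}"

text \<open>Stated through kernel vectors instead of \<open>independent\<close> on the set of
  columns, so that two equal columns at different indices count as dependent.\<close>

definition columns_indep :: "real^'n^'m \<Rightarrow> 'n set \<Rightarrow> bool" where
  "columns_indep A S \<longleftrightarrow> (\<forall>d \<in> supported_on S. A *v d = 0 \<longrightarrow> d = 0)"

lemma matrix_vector_mult_supported:
  fixes A :: "real^'n^'m"
  assumes "d \<in> supported_on S"
  shows "A *v d = (\<Sum>j\<in>S. d $ j *\<^sub>R column j A)"
proof -
  have "A *v d = (\<Sum>j\<in>UNIV. d $ j *\<^sub>R column j A)"
    by (simp add: matrix_mult_sum scalar_mult_eq_scaleR)
  also have "\<dots> = (\<Sum>j\<in>S. d $ j *\<^sub>R column j A)"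
    using assms by (intro sum.mono_neutral_right) (auto simp: supported_on_def)
  finally show ?thesis .
qed

lemma columns_indep_inj_on:
  fixes A :: "real^'n^'m"
  assumes "columns_indep A S"
  shows "inj_on (\<lambda>j. column j A) S"
proof (rule inj_onI)
  fix i j assume ij: "i \<in> S" "j \<in> S" "column i A = column j A"
  let ?d = "axis i 1 - axis j 1 :: real^'n"
  have "?d \<in> supported_on S" using ij by (auto simp: supported_on_def axis_def)
  moreover have "A *v ?d = 0"
    using ij(3) by (simp add: matrix_vector_mult_diff_distrib matrix_vector_mult_basis)
  ultimately have "?d = 0" using assms by (auto simp: columns_indep_def)
  then show "i = j" by (simp add: axis_eq_axis)
qed

lemma columns_indep_independent:
  fixes A :: "real^'n^'m"
  assumes "columns_indep A S"
  shows "independent ((\<lambda>j. column j A) ` S)"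
proof (rule independent_if_scalars_zero)
  let ?f = "\<lambda>j. column j A"
  show "finite (?f ` S)" by simp
  fix u v assume *: "(\<Sum>v\<in>?f ` S. u v *\<^sub>R v) = 0" and v: "v \<in> ?f ` S"
  define d :: "real^'n" where "d = (\<chi> j. if j \<in> S then u (?f j) else 0)"
  have d: "d \<in> supported_on S" by (simp add: supported_on_def d_def)
  have "A *v d = (\<Sum>j\<in>S. u (?f j) *\<^sub>R ?f j)"
    unfolding matrix_vector_mult_supported[OF d] by (intro sum.cong) (auto simp: d_def)
  also have "\<dots> = 0"
    using * by (simp add: sum.reindex[OF columns_indep_inj_on[OF assms]])
  finally have "d = 0" using assms d by (auto simp: columns_indep_def)
  then show "u v = 0" using v by (auto simp: d_def vec_eq_iff split: if_splits)
qed

lemma columns_indep_surj: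
  fixes A :: "real^'n^'m"
  assumes "columns_indep A S" and "card S = CARD('m)"
  shows "\<exists>d \<in> supported_on S. A *v d = v"
proof -
  let ?f = "\<lambda>j. column j A"
  have "card (?f ` S) = DIM(real^'m)"
    using assms by (simp add: card_image columns_indep_inj_on)
  \<comment> \<open>As many independent vectors as the dimension of the space span it.\<close>
  then have "span (?f ` S) = UNIV"
    by (metis columns_indep_independent[OF assms(1)] dim_eq_card_independent dim_eq_full)
  moreover have "span (?f ` S) \<subseteq> (\<lambda>d. A *v d) ` supported_on S"
  proof (rule span_minimal)
    show "?f ` S \<subseteq> (\<lambda>d. A *v d) ` supported_on S"
    proof
      fix w assume "w \<in> ?f ` S"
      then obtain j where "j \<in> S" "w = ?f j" by auto
      then have "w = A *v axis j 1" "axis j 1 \<in> supported_on S"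
        by (simp_all add: matrix_vector_mult_basis) (auto simp: supported_on_def axis_def)
      then show "w \<in> (\<lambda>d. A *v d) ` supported_on S" by (rule image_eqI)
    qed
    have "subspace (supported_on S)"
      by (auto simp: subspace_def supported_on_def)
    then show "subspace ((\<lambda>d. A *v d) ` supported_on S)"
      by (rule linear_subspace_image[OF matrix_vector_mul_linear])
  qed
  ultimately have "v \<in> (\<lambda>d. A *v d) ` supported_on S" by auto
  then show ?thesis by (simp add: image_iff eq_commute[of v])
qed

section \<open>Supports of feasible points under non-degeneracy\<close>

text \<open>Moving from \<open>x\<close> along a kernel vector with a negative entry, until the
  first coordinate vanishes, would give a feasible point of strictly smaller support. So no kernel
  vector on the support has a negative entry; applied to \<open>d\<close> and to \<open>- d\<close>,
  this gives \<open>d = 0\<close>.\<close>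

lemma minimal_support_columns_indep:
  fixes A :: "real^'n^'m"
  assumes x: "x \<in> primal_feasible A b"
    and min: "\<And>x'. x' \<in> primal_feasible A b \<Longrightarrow> card {j. 0 < x $ j} \<le> card {j. 0 < x' $ j}"
  shows "columns_indep A {j. 0 < x $ j}"
proof -
  have nonneg: "\<forall>j. 0 \<le> d $ j"
    if d: "d \<in> supported_on {j. 0 < x $ j}" "A *v d = 0" for d
  proof (rule ccontr)
    assume "\<not> (\<forall>j. 0 \<le> d $ j)"
    then have J: "{j. d $ j < 0} \<noteq> {}" by (auto simp: not_le)
    \<comment> \<open>Ratio test: the longest step along \<open>d\<close> that keeps all coordinates
      nonnegative. Coordinate \<open>j0\<close>, which attains the minimum, drops to zero.\<close>
    define t where "t = Min ((\<lambda>j. x $ j / - d $ j) ` {j. d $ j < 0})"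
    have "t \<in> (\<lambda>j. x $ j / - d $ j) ` {j. d $ j < 0}"
      unfolding t_def using J by (intro Min_in) auto
    then obtain j0 where j0: "d $ j0 < 0" "t = x $ j0 / - d $ j0" by auto
    have t_le: "t \<le> x $ j / - d $ j" if "d $ j < 0" for j
      unfolding t_def using that by (intro Min_le) auto
    have x0: "0 \<le> x $ j" for j using x by (simp add: primal_feasible_def)
    have "0 \<le> t" using j0 x0[of j0] by (simp add: divide_nonneg_neg)
    let ?x = "x + t *\<^sub>R d"
    have "0 \<le> ?x $ j" for j
    proof (cases "d $ j < 0")
      case True
      then show ?thesis using t_le[OF True] by (simp add: field_simps)
    next
      case False
      then show ?thesis using x0[of j] \<open>0 \<le> t\<close> by simp
    qed
    then have feas: "?x \<in> primal_feasible A b"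
      using x d(2) by (simp add: primal_feasible_def matrix_vector_right_distrib
          matrix_vector_mult_scaleR)
    have "?x $ j0 = 0" using j0 by (simp add: field_simps)
    moreover have "0 < x $ j0"
      using d(1) j0(1) by (auto simp: supported_on_def)
    moreover have "{j. 0 < ?x $ j} \<subseteq> {j. 0 < x $ j}"
      using d(1) x0 by (force simp: supported_on_def less_le)
    ultimately have "{j. 0 < ?x $ j} \<subset> {j. 0 < x $ j}" by force
    then have "card {j. 0 < ?x $ j} < card {j. 0 < x $ j}"
      by (intro psubset_card_mono) auto
    then show False using min[OF feas] by simp
  qed
  show ?thesis unfolding columns_indep_def
  proof (intro ballI impI)
    fix d assume d: "d \<in> supported_on {j. 0 < x $ j}" "A *v d = 0"
    have "A *v (- d) = 0"
      using d(2) matrix_vector_mult_diff_distrib[of A 0 d] by simp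
    then have "\<forall>j. 0 \<le> (- d) $ j"
      using d(1) by (intro nonneg) (auto simp: supported_on_def)
    then show "d = 0" using nonneg[OF d] by (auto simp: vec_eq_iff intro: antisym)
  qed
qed

text \<open>The support may have fewer than \<open>m\<close> elements, while
  \<open>basic_feasible\<close> asks for a full basis; full rank allows the columns of the support
  to be extended to one.\<close>

lemma basic_feasible_if_columns_indep:
  fixes A :: "real^'n^'m"
  assumes x: "x \<in> primal_feasible A b" and indep: "columns_indep A {j. 0 < x $ j}"
    and rank: "rank A = CARD('m)"
  shows "x \<in> basic_feasible A b"
proof -
  let ?f = "\<lambda>j. column j A" and ?S = "{j. 0 < x $ j}"
  obtain V where V: "?f ` ?S \<subseteq> V" "V \<subseteq> range ?f" "independent V" "range ?f \<subseteq> span V"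
    using maximal_independent_subset_extend[of "?f ` ?S" "range ?f"]
      columns_indep_independent[OF indep] by auto
  have cols: "columns A = range ?f" by (auto simp: columns_def)
  have cardV: "card V = CARD('m)"
    using basis_card_eq_dim[OF V(2,4,3)] rank unfolding column_rank_def cols by (rule trans)
  \<comment> \<open>The basis \<open>V\<close> is a set of columns, so one index is picked for each
    added column. The added columns differ from those of the support, hence \<open>column\<close>
    stays injective on the union.\<close>
  have "V - ?f ` ?S \<subseteq> range ?f" using V(2) by (rule subset_trans[OF Diff_subset])
  then obtain J' where J': "inj_on ?f J'" "V - ?f ` ?S = ?f ` J'"
    unfolding subset_image_inj by (elim exE conjE)
  have "?f ` ?S \<inter> ?f ` J' = {}" unfolding J'(2)[symmetric] by (rule Diff_disjoint)
  then have inj: "inj_on ?f (?S \<union> J')"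
    using J'(1) columns_indep_inj_on[OF indep] unfolding inj_on_Un by fast
  have img: "?f ` (?S \<union> J') = V"
    unfolding image_Un J'(2)[symmetric] using V(1) by (rule Diff_partition)
  have "x $ j = 0" if "j \<notin> ?S \<union> J'" for j
    using that x by (auto simp: primal_feasible_def not_less intro: antisym)
  moreover have "card (?S \<union> J') = CARD('m)"
    using card_image[OF inj] by (simp only: img cardV)
  ultimately show ?thesis
    unfolding basic_feasible_def using x inj img V(3) by blast
qed

lemma card_support_ge:
  fixes A :: "real^'n^'m"
  assumes "primal_nondegenerate A b" and "rank A = CARD('m)" and "x \<in> primal_feasible A b"
  shows "CARD('m) \<le> card {j. 0 < x $ j}"
proof -
  obtain w where w: "w \<in> primal_feasible A b"
    "\<And>x'. x' \<in> primal_feasible A b \<Longrightarrow> card {j. 0 < w $ j} \<le> card {j. 0 < x' $ j}"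
    using ex_has_least_nat[of "\<lambda>x. x \<in> primal_feasible A b" x "\<lambda>x. card {j. 0 < x $ j}"]
      assms(3) by blast
  then have "w \<in> basic_feasible A b"
    using minimal_support_columns_indep basic_feasible_if_columns_indep assms(2) by blast
  then have "card {j. 0 < w $ j} = CARD('m)"
    using assms(1) by (simp add: primal_nondegenerate_def)
  then show ?thesis using w(2)[OF assms(3)] by simp
qed

lemma B_part_support:
  fixes A :: "real^'n^'m"
  assumes "primal_nondegenerate A b" and "rank A = CARD('m)"
    and "card (B_part A b c) = CARD('m)" and z: "z \<in> primal_optimal A b c"
  shows "{j. 0 < z $ j} = B_part A b c" and "columns_indep A (B_part A b c)"
proof -
  have feas: "z \<in> primal_feasible A b" using z by (simp add: primal_optimal_def)
  have "{j. 0 < z $ j} \<subseteq> B_part A b c" using z by (auto simp: B_part_def)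
  then show supp: "{j. 0 < z $ j} = B_part A b c"
    using card_support_ge[OF assms(1,2) feas] assms(3) by (intro card_seteq) auto
  \<comment> \<open>The support of \<open>z\<close> has exactly \<open>m\<close> elements, the lower
    bound for every feasible point, so it is of least cardinality.\<close>
  have "columns_indep A {j. 0 < z $ j}"
    using card_support_ge[OF assms(1,2)] supp assms(3)
    by (intro minimal_support_columns_indep[OF feas]) auto
  then show "columns_indep A (B_part A b c)" by (simp add: supp)
qed

section \<open>Sharpness of the optimal solution\<close>

text \<open>For small \<open>t\<close> the positive coordinates stay positive by continuity, and the
  zero ones cannot decrease. As there are finitely many coordinates, one \<open>t\<close> serves
  all.\<close>

lemma step_feasible:
  fixes A :: "real^'n^'m"
  assumes z: "z \<in> primal_feasible A b" and D: "A *v D = 0"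
    and nonneg: "\<And>j. z $ j = 0 \<Longrightarrow> 0 \<le> D $ j"
  shows "\<exists>t>0. z + t *\<^sub>R D \<in> primal_feasible A b"
proof -
  have z0: "0 \<le> z $ j" for j using z by (simp add: primal_feasible_def)
  have "\<forall>\<^sub>F t in at_right 0. 0 \<le> z $ j + t * D $ j" for j
  proof (cases "z $ j = 0")
    case True
    have "\<forall>\<^sub>F t::real in at_right 0. 0 < t" by (rule eventually_at_right_less)
    then show ?thesis by eventually_elim (simp add: True nonneg)
  next
    case False
    have "((\<lambda>t. z $ j + t * D $ j) \<longlongrightarrow> z $ j + 0 * D $ j) (at_right 0)"
      by (intro tendsto_intros)
    moreover have "0 < z $ j + 0 * D $ j" using False z0[of j] by simp
    ultimately have "\<forall>\<^sub>F t in at_right 0. 0 < z $ j + t * D $ j"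
      by (rule order_tendstoD(1))
    then show ?thesis by eventually_elim simp
  qed
  then have "\<forall>\<^sub>F t in at_right 0. \<forall>j. 0 \<le> z $ j + t * D $ j"
    by (rule eventually_all_finite)
  moreover have "\<forall>\<^sub>F t::real in at_right 0. 0 < t" by (rule eventually_at_right_less)
  ultimately have "\<forall>\<^sub>F t in at_right 0. 0 < t \<and> (\<forall>j. 0 \<le> z $ j + t * D $ j)"
    by eventually_elim simp
  then obtain t :: real where "0 < t" "\<forall>j. 0 \<le> z $ j + t * D $ j"
    using eventually_happens'[OF trivial_limit_at_right_real] by blast
  then show ?thesis
    using z D by (intro exI[of _ t]) (simp add: primal_feasible_def matrix_vector_right_distrib
        matrix_vector_mult_scaleR)
qed

lemma sharp_minimum:
  fixes A :: "real^'n^'m"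
  assumes indep: "columns_indep A (B_part A b c)" and card: "card (B_part A b c) = CARD('m)"
    and z: "z \<in> primal_optimal A b c" and supp: "{j. 0 < z $ j} = B_part A b c"
  shows "\<exists>K\<ge>0. \<forall>x \<in> primal_feasible A b. norm (x - z) \<le> K * (c \<bullet> x - c \<bullet> z)"
proof -
  let ?B = "B_part A b c"
  have zf: "z \<in> primal_feasible A b"
    and zopt: "\<And>x. x \<in> primal_feasible A b \<Longrightarrow> c \<bullet> z \<le> c \<bullet> x"
    using z by (auto simp: primal_optimal_def)
  have zB: "z $ j = 0 \<longleftrightarrow> j \<notin> ?B" for j
    using zf supp by (auto simp: primal_feasible_def less_le)
  have "\<exists>d \<in> supported_on ?B. A *v d = - column k A" for k
    by (rule columns_indep_surj[OF indep card])
  then obtain d where d: "\<And>k. d k \<in> supported_on ?B" "\<And>k. A *v d k = - column k A"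
    by metis
  \<comment> \<open>The part \<open>d k\<close> in the basic coordinates cancels the column
    \<open>k\<close>, so \<open>D k\<close> lies in the kernel of \<open>A\<close>.\<close>
  define D where "D k = axis k 1 + d k" for k
  have AD: "A *v D k = 0" for k
    by (simp add: D_def d(2) matrix_vector_right_distrib matrix_vector_mult_basis)
  have D_off: "D k $ j = (if j = k then 1 else 0)" if "j \<notin> ?B" for j k
    using d(1)[of k] that by (auto simp: D_def supported_on_def axis_def)
  have pos: "0 < c \<bullet> D k" if k: "k \<notin> ?B" for k
  proof -
    obtain t where t: "t > 0" "z + t *\<^sub>R D k \<in> primal_feasible A b"
      using step_feasible[OF zf AD[of k]] zB D_off by force
    have "0 < (z + t *\<^sub>R D k) $ k" using t(1) zB[of k] D_off[OF k, of k] k by simp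
    then have "z + t *\<^sub>R D k \<notin> primal_optimal A b c" using k by (auto simp: B_part_def)
    then obtain w where "w \<in> primal_feasible A b" "c \<bullet> w < c \<bullet> (z + t *\<^sub>R D k)"
      using t(2) by (auto simp: primal_optimal_def not_le)
    with zopt have "c \<bullet> z < c \<bullet> (z + t *\<^sub>R D k)" by fastforce
    then show ?thesis using t(1) by (simp add: inner_add_right zero_less_mult_iff)
  qed
  \<comment> \<open>A sum of nonnegative ratios bounds each of them, and it is also defined when the
    complement of \<open>?B\<close> is empty.\<close>
  define K where "K = (\<Sum>k\<in>-?B. norm (D k) / (c \<bullet> D k))"
  have "0 \<le> K" unfolding K_def using pos by (intro sum_nonneg) (auto simp: less_imp_le)
  moreover have "norm (x - z) \<le> K * (c \<bullet> x - c \<bullet> z)" if x: "x \<in> primal_feasible A b" for x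
  proof -
    let ?h = "x - z"
    have xh: "?h $ k = x $ k" if "k \<notin> ?B" for k using zB[of k] that by simp
    have x0: "0 \<le> x $ k" for k using x by (simp add: primal_feasible_def)
    \<comment> \<open>Since \<open>z\<close> vanishes outside \<open>?B\<close>, \<open>?g\<close>
      and \<open>?h\<close> agree there. Their difference is a kernel vector supported on
      \<open>?B\<close>, hence zero.\<close>
    let ?g = "\<Sum>k\<in>-?B. x $ k *\<^sub>R D k"
    have "A *v ?g = 0"
      by (simp add: linear_sum[OF matrix_vector_mul_linear] matrix_vector_mult_scaleR AD)
    then have "A *v (?h - ?g) = 0"
      using x zf by (simp add: matrix_vector_mult_diff_distrib primal_feasible_def)
    moreover have "?h - ?g \<in> supported_on ?B"
      by (simp add: supported_on_def xh zB D_off if_distrib cong: if_cong)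
    ultimately have "?h - ?g = 0" using indep by (auto simp: columns_indep_def)
    then have h: "?h = ?g" by simp
    have ch: "c \<bullet> x - c \<bullet> z = (\<Sum>k\<in>-?B. x $ k * (c \<bullet> D k))"
      using arg_cong[OF h, of "(\<bullet>) c"] by (simp add: inner_diff_right inner_sum_right)
    have "norm ?h \<le> (\<Sum>k\<in>-?B. norm (x $ k *\<^sub>R D k))"
      unfolding h by (rule norm_sum)
    also have "\<dots> \<le> (\<Sum>k\<in>-?B. K * (x $ k * (c \<bullet> D k)))"
    proof (rule sum_mono)
      fix k assume k: "k \<in> -?B"
      have "norm (D k) / (c \<bullet> D k) \<le> K"
        unfolding K_def using k pos by (intro member_le_sum) (auto simp: less_imp_le)
      then have "norm (D k) \<le> K * (c \<bullet> D k)" using pos[of k] k by (simp add: field_simps)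
      then have "x $ k * norm (D k) \<le> x $ k * (K * (c \<bullet> D k))"
        using x0 by (rule mult_left_mono)
      then show "norm (x $ k *\<^sub>R D k) \<le> K * (x $ k * (c \<bullet> D k))"
        using x0[of k] by (simp add: mult_ac)
    qed
    also have "\<dots> = K * (c \<bullet> x - c \<bullet> z)" by (simp add: ch sum_distrib_left)
    finally show ?thesis .
  qed
  ultimately show ?thesis by blast
qed

section \<open>Duality gap of the iterates\<close>

lemma dual_objective:
  fixes A :: "real^'n^'m"
  assumes "x \<in> primal_feasible A b" and "(y, s) \<in> dual_feasible A c"
  shows "c \<bullet> x = y \<bullet> b + s \<bullet> x"
proof -
  have "c = transpose A *v y + s" "A *v x = b"
    using assms by (auto simp: primal_feasible_def dual_feasible_def)
  then show ?thesis
    by (auto simp: inner_add_left dot_lmul_matrix vector_transpose_matrix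
        transpose_matrix_vector)
qed

text \<open>Both objective values are expanded with the dual point attaining the proximity; the term
  \<open>y \<bullet> b\<close> cancels and \<open>s \<bullet> z\<close> is nonnegative, leaving
  \<open>s \<bullet> x\<close>. A norm at most 1 bounds every component by 1, so each product
  \<open>s $ j * x $ j\<close> is at most \<open>2 * \<mu>\<close>.\<close>

lemma gap_le:
  fixes A :: "real^'n^'m"
  assumes x: "x \<in> primal_interior A b" and z: "z \<in> primal_feasible A b"
    and dual: "dual_feasible A c \<noteq> {}" and \<mu>: "0 < \<mu>" and prox: "proximity A c x \<mu> \<le> 1"
  shows "c \<bullet> x - c \<bullet> z \<le> 2 * real CARD('n) * \<mu>"
proof -
  have xf: "x \<in> primal_feasible A b" and xpos: "\<forall>j. 0 < x $ j"
    using x by (auto simp: primal_interior_def)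
  obtain y s where ys: "(y, s) \<in> dual_feasible A c"
    and eq: "proximity A c x \<mu> = norm ((1 / \<mu>) *\<^sub>R (diag_mat x *v s) - 1)"
    using proximity_attained[OF dual xpos \<mu>] by auto
  have xs: "s $ j * x $ j \<le> 2 * \<mu>" for j
  proof -
    have "\<bar>((1 / \<mu>) *\<^sub>R (diag_mat x *v s) - 1) $ j\<bar> \<le> 1"
      using component_le_norm_cart prox eq by (metis order_trans)
    then have "x $ j * s $ j / \<mu> - 1 \<le> 1" by (simp add: diag_mat_mult)
    then show ?thesis using \<mu> by (simp add: field_simps)
  qed
  have "0 \<le> s \<bullet> z"
    using z ys by (auto simp: inner_vec_def primal_feasible_def dual_feasible_def
        intro!: sum_nonneg)
  then have "c \<bullet> x - c \<bullet> z \<le> s \<bullet> x"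
    using dual_objective[OF xf ys] dual_objective[OF z ys] by simp
  also have "\<dots> \<le> (\<Sum>j\<in>(UNIV::'n set). 2 * \<mu>)"
    unfolding inner_vec_def by (intro sum_mono) (simp add: xs)
  also have "\<dots> = 2 * real CARD('n) * \<mu>" by simp
  finally show ?thesis .
qed

theorem theorem3p1:
  fixes A :: "real^'n^'m" and b :: "real^'m" and c :: "real^'n" and \<tau> :: real
  assumes "assumption_A1 A b c"
    and "assumption_A2 A b c"
    and "0 < \<tau>" and "\<tau> \<le> 1 / sqrt (2 * real CARD('n))"
  shows "\<exists>C::real. \<forall>(\<mu> :: nat \<Rightarrow> real) (x :: nat \<Rightarrow> real^'n).
           0 < \<mu> 1 \<longrightarrow>
           (\<forall>k\<ge>1. \<mu> (k + 1) = (1 - \<tau>) * \<mu> k) \<longrightarrow>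
           (\<forall>k\<ge>1. x k \<in> primal_interior A b) \<longrightarrow>
           (\<forall>k\<ge>1. proximity A c (x k) (\<mu> k) \<le> sqrt 2 / 2) \<longrightarrow>
           (\<forall>k\<ge>1. \<forall>i\<ge>k. \<forall>j\<ge>k. norm (x i - x j) \<le> C * \<mu> k)"
proof -
  have rank: "rank A = CARD('m)" and dual: "dual_feasible A c \<noteq> {}"
    using assms(1) by (auto simp: assumption_A1_def dual_interior_def)
  have nondeg: "primal_nondegenerate A b" and card: "card (B_part A b c) = CARD('m)"
    using assms(2) by (auto simp: assumption_A2_def)
  \<comment> \<open>An optimal \<open>z\<close> exists because \<open>m\<close> is positive. It is
    fixed before the sequences, so that \<open>K\<close> depends only on the problem data.\<close>
  from card have "B_part A b c \<noteq> {}" by auto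
  then obtain z where z: "z \<in> primal_optimal A b c" by (auto simp: B_part_def)
  then have zf: "z \<in> primal_feasible A b" by (simp add: primal_optimal_def)
  obtain K where K: "K \<ge> 0"
    "\<And>x. x \<in> primal_feasible A b \<Longrightarrow> norm (x - z) \<le> K * (c \<bullet> x - c \<bullet> z)"
    using sharp_minimum[OF _ card z] B_part_support[OF nondeg rank card z] by blast
  \<comment> \<open>This gives \<open>\<tau> < 1\<close>, which keeps all \<open>\<mu> l\<close>
    positive.\<close>
  have "1 < sqrt (2 * real CARD('n))" by (simp add: Suc_le_eq less_1_mult')
  then have "1 / sqrt (2 * real CARD('n)) < 1" by simp
  with assms(4) have "\<tau> < 1" by linarith
  define L where "L = K * (2 * real CARD('n))"
  show ?thesis
  proof (intro exI[of _ "2 * L"] allI impI)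
    fix \<mu> :: "nat \<Rightarrow> real" and x :: "nat \<Rightarrow> real^'n" and k i j :: nat
    assume \<mu>1: "0 < \<mu> 1" and rec: "\<forall>k\<ge>1. \<mu> (k + 1) = (1 - \<tau>) * \<mu> k"
      and int: "\<forall>k\<ge>1. x k \<in> primal_interior A b"
      and prox: "\<forall>k\<ge>1. proximity A c (x k) (\<mu> k) \<le> sqrt 2 / 2"
      and k: "1 \<le> k" and i: "k \<le> i" and j: "k \<le> j"
    have pos: "0 < \<mu> l" if "1 \<le> l" for l
      using that
    proof (induction l rule: dec_induct)
      case base
      show ?case by (rule \<mu>1)
    next
      case (step l)
      then show ?case using rec \<open>\<tau> < 1\<close> by simp
    qed
    have mono: "\<mu> l \<le> \<mu> k" if "k \<le> l" for l
      using that
    proof (induction l rule: dec_induct)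
      case base
      show ?case by simp
    next
      case (step l)
      have "\<mu> (Suc l) = \<mu> l - \<tau> * \<mu> l" using rec step(1) k by (simp add: algebra_simps)
      moreover have "0 \<le> \<tau> * \<mu> l" using assms(3) pos[of l] step(1) k by simp
      ultimately show ?case using step.IH by simp
    qed
    have bound: "norm (x l - z) \<le> L * \<mu> k" if "k \<le> l" for l
    proof -
      have l: "1 \<le> l" using k that by simp
      have xl: "x l \<in> primal_interior A b" using int l by simp
      have "sqrt 2 / 2 \<le> (1::real)" by (simp add: real_le_lsqrt)
      with prox l have "proximity A c (x l) (\<mu> l) \<le> 1" by (meson order_trans)
      then have gap: "c \<bullet> x l - c \<bullet> z \<le> 2 * real CARD('n) * \<mu> l"
        by (rule gap_le[OF xl zf dual pos[OF l]])
      have "norm (x l - z) \<le> K * (c \<bullet> x l - c \<bullet> z)"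
        using xl by (intro K(2)) (simp add: primal_interior_def)
      also have "\<dots> \<le> K * (2 * real CARD('n) * \<mu> l)"
        using gap K(1) by (rule mult_left_mono)
      also have "\<dots> = L * \<mu> l" by (simp add: L_def)
      also have "\<dots> \<le> L * \<mu> k"
        using mono[OF that] K(1) by (intro mult_left_mono) (auto simp: L_def)
      finally show ?thesis .
    qed
    \<comment> \<open>Both iterates are compared with \<open>z\<close>, whence the factor 2 in the
      constant.\<close>
    have "norm (x i - x j) \<le> norm (x i - z) + norm (x j - z)"
      using norm_triangle_ineq4[of "x i - z" "x j - z"] by simp
    also have "\<dots> \<le> 2 * L * \<mu> k" using bound[OF i] bound[OF j] by simp
    finally show "norm (x i - x j) \<le> 2 * L * \<mu> k" .
  qed
qed

end
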